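(* Let $S=\mathscr{M}[G;I,\Lambda;P]$ be a completely simple semigroup. Identify each normal cone $\gamma$ in $\mathcal{L}(S)$ with vertex $\bar\lambda$ with the pair $(\bar\gamma,\lambda)\in G^\Lambda\times\Lambda$, where $\gamma(\bar\mu)=\rho(\bar\gamma(\mu))$ for all $\mu\in\Lambda$. Under this identification the semigroup $T\mathcal{L}(S)$ of normal cones in $\mathcal{L}(S)$ is the semidirect product $G^\Lambda\ltimes\Lambda$ with respect to the left action of the right zero semigroup $\Lambda$ on the group $G^\Lambda$ given by $\lambda_k\ast\bar g=(g_k,g_k,\dots)$ (the constant function with value $g_k=\bar g(\lambda_k)$), for $\lambda_k\in\Lambda$, $\bar g\in G^\Lambda$.
   Context: $G$ is a group, $I,\Lambda$ are nonempty sets, $P=(p_{\lambda i})$ is a $\Lambda\times I$ matrix over $G$, and $S=\mathscr{M}[G;I,\Lambda;P]=G\times I\times\Lambda$ with product $(a,i,\lambda)(b,j,\mu)=(ap_{\lambda j}b,i,\mu)$. Category $\mathcal{L}(S)$ (composition written left to right): objects are the principal left ideals $Se$, $e$ idempotent; morphisms $Se\to Sf$ are the right translations $x\mapsto xs$ with $s\in eSf$; inclusions are the set inclusions $Se\subseteq Sf$. For the present $S$ the objects are $\bar\lambda=G\times I\times\{\lambda\}$, $\lambda\in\Lambda$, and the morphisms $\bar\lambda_1\to\bar\lambda_2$ are the maps $\rho(g):(h,i,\lambda_1)\mapsto(hg,i,\lambda_2)$, $g\in G$. Normal cones: a cone with vertex $d$ in a category $\mathcal{C}$ with designated inclusions $j(c',c)$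 is a map $\gamma$ assigning to each object $c$ a morphism $\gamma(c):c\to d$ such that $j(c',c)\gamma(c)=\gamma(c')$ whenever $c'\subseteq c$; it is normal if some $\gamma(c)$ is an isomorphism. $c_\gamma$ denotes the vertex of $\gamma$. $T\mathcal{C}$ is the set of normal cones with product $(\gamma\ast\sigma)(a)=\gamma(a)(\sigma(c_\gamma))^\circ$, where $f^\circ=eu$ is the epimorphic component of $f$, for a factorization $f=euj$ into a retraction $e$ (a left-to-right right inverse of an inclusion), an isomorphism $u$ and an inclusion $j$. $G^\Lambda$ is the group of functions $\Lambda\to G$ under pointwise product; $\Lambda$ is a right zero semigroup ($\lambda_k\lambda_l=\lambda_l$). For a left action of a semigroup $T$ on a semigroup $U$ (i.e. $(t_1t_2)\ast s=t_1\ast(t_2\ast s)$ and $t\ast(s_1s_2)=(t\ast s_1)(t\ast s_2)$), $U\ltimes T$ is $U\times T$ with product $(s_1,t_1)(s_2,t_2)=(s_1(t_1\ast s_2),t_1t_2)$. *)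

theory Defs
  imports "HOL-Algebra.Product_Groups"
begin

section \<open>Semigroups\<close>

record 'a sgrp = "'a partial_object" +
  smult :: "'a \<Rightarrow> 'a \<Rightarrow> 'a"

definition is_semigroup :: "('a, 'x) sgrp_scheme \<Rightarrow> bool" where
  "is_semigroup S \<longleftrightarrow>
     (\<forall>x\<in>carrier S. \<forall>y\<in>carrier S. smult S x y \<in> carrier S) \<and>
     (\<forall>x\<in>carrier S. \<forall>y\<in>carrier S. \<forall>z\<in>carrier S.
        smult S (smult S x y) z = smult S x (smult S y z))"

definition sgrp_iso :: "('a, 'x) sgrp_scheme \<Rightarrow> ('b, 'y) sgrp_scheme \<Rightarrow> ('a \<Rightarrow> 'b) \<Rightarrow> bool" where
  "sgrp_iso S T \<phi> \<longleftrightarrow>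
     is_semigroup S \<and> is_semigroup T \<and>
     bij_betw \<phi> (carrier S) (carrier T) \<and>
     (\<forall>x\<in>carrier S. \<forall>y\<in>carrier S. \<phi> (smult S x y) = smult T (\<phi> x) (\<phi> y))"

definition sgrp_of :: "('a, 'x) monoid_scheme \<Rightarrow> 'a sgrp" where
  "sgrp_of M = \<lparr>carrier = carrier M, smult = mult M\<rparr>"

definition idempotents :: "('a, 'x) sgrp_scheme \<Rightarrow> 'a set" where
  "idempotents S = {e \<in> carrier S. smult S e e = e}"

definition principal_left_ideal :: "('a, 'x) sgrp_scheme \<Rightarrow> 'a \<Rightarrow> 'a set" where
  "principal_left_ideal S e = {smult S x e |x. x \<in> carrier S}"

definition left_action ::
  "('t, 'x) sgrp_scheme \<Rightarrow> ('u, 'y) sgrp_scheme \<Rightarrow> ('t \<Rightarrow> 'u \<Rightarrow> 'u) \<Rightarrow> bool" where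
  "left_action T U act \<longleftrightarrow>
     (\<forall>t\<in>carrier T. \<forall>s\<in>carrier U. act t s \<in> carrier U) \<and>
     (\<forall>t1\<in>carrier T. \<forall>t2\<in>carrier T. \<forall>s\<in>carrier U. act (smult T t1 t2) s = act t1 (act t2 s)) \<and>
     (\<forall>t\<in>carrier T. \<forall>s1\<in>carrier U. \<forall>s2\<in>carrier U.
        act t (smult U s1 s2) = smult U (act t s1) (act t s2))"

definition semidirect ::
  "('u, 'y) sgrp_scheme \<Rightarrow> ('t, 'x) sgrp_scheme \<Rightarrow> ('t \<Rightarrow> 'u \<Rightarrow> 'u) \<Rightarrow> ('u \<times> 't) sgrp" where
  "semidirect U T act =
     \<lparr>carrier = carrier U \<times> carrier T,
      smult = (\<lambda>(s1, t1) (s2, t2). (smult U s1 (act t1 s2), smult T t1 t2))\<rparr>"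

definition right_zero :: "'l set \<Rightarrow> 'l sgrp" where
  "right_zero \<Lambda> = \<lparr>carrier = \<Lambda>, smult = (\<lambda>k l. l)\<rparr>"

definition rees_matrix ::
  "('g, 'x) monoid_scheme \<Rightarrow> 'i set \<Rightarrow> 'l set \<Rightarrow> ('l \<Rightarrow> 'i \<Rightarrow> 'g) \<Rightarrow> ('g \<times> 'i \<times> 'l) sgrp" where
  "rees_matrix G I \<Lambda> P =
     \<lparr>carrier = carrier G \<times> I \<times> \<Lambda>,
      smult = (\<lambda>(a, i, l) (b, j, m). (a \<otimes>\<^bsub>G\<^esub> P l j \<otimes>\<^bsub>G\<^esub> b, i, m))\<rparr>"


section \<open>Categories with designated inclusions and their normal cones\<close>

text \<open>Composition is written left to right: \<open>cmp C f g\<close> is \<open>f\<close> followed by \<open>g\<close>.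
  \<open>incl C c' c\<close> is meaningful only when \<open>sub C c' c\<close> holds.\<close>

record ('o, 'm) incl_cat =
  obj :: "'o set"
  arr :: "'m set"
  src :: "'m \<Rightarrow> 'o"
  tgt :: "'m \<Rightarrow> 'o"
  idn :: "'o \<Rightarrow> 'm"
  cmp :: "'m \<Rightarrow> 'm \<Rightarrow> 'm"
  sub :: "'o \<Rightarrow> 'o \<Rightarrow> bool"
  incl :: "'o \<Rightarrow> 'o \<Rightarrow> 'm"

definition homs :: "('o, 'm) incl_cat \<Rightarrow> 'o \<Rightarrow> 'o \<Rightarrow> 'm set" where
  "homs C a b = {f \<in> arr C. src C f = a \<and> tgt C f = b}"

definition is_isomorphism :: "('o, 'm) incl_cat \<Rightarrow> 'm \<Rightarrow> bool" where
  "is_isomorphism C u \<longleftrightarrow> u \<in> arr C \<and>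
     (\<exists>v \<in> homs C (tgt C u) (src C u).
        cmp C u v = idn C (src C u) \<and> cmp C v u = idn C (tgt C u))"

definition is_inclusion :: "('o, 'm) incl_cat \<Rightarrow> 'm \<Rightarrow> bool" where
  "is_inclusion C j \<longleftrightarrow> (\<exists>c'\<in>obj C. \<exists>c\<in>obj C. sub C c' c \<and> j = incl C c' c)"

definition is_retraction :: "('o, 'm) incl_cat \<Rightarrow> 'm \<Rightarrow> bool" where
  "is_retraction C e \<longleftrightarrow>
     (\<exists>c'\<in>obj C. \<exists>c\<in>obj C. sub C c' c \<and> e \<in> homs C c c' \<and> cmp C (incl C c' c) e = idn C c')"

text \<open>\<open>epi_component C f\<close> is meaningful only if all factorizations of \<open>f\<close> have the same epimorphic part.\<close>

definition epi_component :: "('o, 'm) incl_cat \<Rightarrow> 'm \<Rightarrow> 'm" where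
  "epi_component C f = (THE q. \<exists>e u j.
     is_retraction C e \<and> is_isomorphism C u \<and> is_inclusion C j \<and>
     tgt C e = src C u \<and> tgt C u = src C j \<and>
     f = cmp C (cmp C e u) j \<and> q = cmp C e u)"

text \<open>The components of a cone are \<open>undefined\<close> outside the objects, so that equality of cones is
  equality of the vertex and of all components.\<close>

record ('o, 'm) cone =
  vertex :: 'o
  component :: "'o \<Rightarrow> 'm"

definition is_cone :: "('o, 'm) incl_cat \<Rightarrow> ('o, 'm) cone \<Rightarrow> bool" where
  "is_cone C \<gamma> \<longleftrightarrow>
     vertex \<gamma> \<in> obj C \<and>
     component \<gamma> \<in> (\<Pi>\<^sub>E c\<in>obj C. homs C c (vertex \<gamma>)) \<and>
     (\<forall>c'\<in>obj C. \<forall>c\<in>obj C. sub C c' c \<longrightarrow>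
        cmp C (incl C c' c) (component \<gamma> c) = component \<gamma> c')"

definition is_normal_cone :: "('o, 'm) incl_cat \<Rightarrow> ('o, 'm) cone \<Rightarrow> bool" where
  "is_normal_cone C \<gamma> \<longleftrightarrow> is_cone C \<gamma> \<and> (\<exists>c\<in>obj C. is_isomorphism C (component \<gamma> c))"

definition cone_mult ::
  "('o, 'm) incl_cat \<Rightarrow> ('o, 'm) cone \<Rightarrow> ('o, 'm) cone \<Rightarrow> ('o, 'm) cone" where
  "cone_mult C \<gamma> \<sigma> =
     (let q = epi_component C (component \<sigma> (vertex \<gamma>))
      in \<lparr>vertex = tgt C q, component = (\<lambda>a\<in>obj C. cmp C (component \<gamma> a) q)\<rparr>)"

definition normal_cones :: "('o, 'm) incl_cat \<Rightarrow> ('o, 'm) cone sgrp" where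
  "normal_cones C = \<lparr>carrier = {\<gamma>. is_normal_cone C \<gamma>}, smult = cone_mult C\<rparr>"


section \<open>The category of principal left ideals\<close>

text \<open>A morphism is a triple of its domain, its codomain and the underlying map, the map being
  \<open>undefined\<close> outside the domain.\<close>

type_synonym 'a ideal_map = "'a set \<times> 'a set \<times> ('a \<Rightarrow> 'a)"

definition left_ideal_cat :: "('a, 'x) sgrp_scheme \<Rightarrow> ('a set, 'a ideal_map) incl_cat" where
  "left_ideal_cat S =
     \<lparr>obj = principal_left_ideal S ` idempotents S,
      arr = {(principal_left_ideal S e, principal_left_ideal S f,
              \<lambda>x\<in>principal_left_ideal S e. smult S x s) |e f s.
              e \<in> idempotents S \<and> f \<in> idempotents S \<and>
              s \<in> {smult S (smult S e y) f |y. y \<in> carrier S}},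
      src = (\<lambda>(A, B, h). A),
      tgt = (\<lambda>(A, B, h). B),
      idn = (\<lambda>A. (A, A, \<lambda>x\<in>A. x)),
      cmp = (\<lambda>(A, B, h) (B', D, k). (A, D, compose A k h)),
      sub = (\<lambda>A B. A \<subseteq> B),
      incl = (\<lambda>A B. (A, B, \<lambda>x\<in>A. x))\<rparr>"


section \<open>The identification for Rees matrix semigroups\<close>

definition bar :: "('g, 'x) monoid_scheme \<Rightarrow> 'i set \<Rightarrow> 'l \<Rightarrow> ('g \<times> 'i \<times> 'l) set" where
  "bar G I l = carrier G \<times> I \<times> {l}"

definition rho ::
  "('g, 'x) monoid_scheme \<Rightarrow> 'i set \<Rightarrow> 'l \<Rightarrow> 'l \<Rightarrow> 'g \<Rightarrow> ('g \<times> 'i \<times> 'l) ideal_map" where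
  "rho G I l1 l2 g = (bar G I l1, bar G I l2, \<lambda>(h, i, l)\<in>bar G I l1. (h \<otimes>\<^bsub>G\<^esub> g, i, l2))"

definition power_sgrp :: "('g, 'x) monoid_scheme \<Rightarrow> 'l set \<Rightarrow> ('l \<Rightarrow> 'g) sgrp" where
  "power_sgrp G \<Lambda> = sgrp_of (product_group \<Lambda> (\<lambda>_. G))"

definition const_act :: "'l set \<Rightarrow> 'l \<Rightarrow> ('l \<Rightarrow> 'g) \<Rightarrow> ('l \<Rightarrow> 'g)" where
  "const_act \<Lambda> k g = (\<lambda>_\<in>\<Lambda>. g k)"

definition cone_semidirect ::
  "('g, 'x) monoid_scheme \<Rightarrow> 'l set \<Rightarrow> (('l \<Rightarrow> 'g) \<times> 'l) sgrp" where
  "cone_semidirect G \<Lambda> = semidirect (power_sgrp G \<Lambda>) (right_zero \<Lambda>) (const_act \<Lambda>)"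

definition corresponds ::
  "('g, 'x) monoid_scheme \<Rightarrow> 'i set \<Rightarrow> 'l set \<Rightarrow>
   (('g \<times> 'i \<times> 'l) set, ('g \<times> 'i \<times> 'l) ideal_map) cone \<Rightarrow> ('l \<Rightarrow> 'g) \<times> 'l \<Rightarrow> bool" where
  "corresponds G I \<Lambda> \<gamma> p \<longleftrightarrow>
     (case p of (g, l) \<Rightarrow>
        g \<in> (\<Pi>\<^sub>E m\<in>\<Lambda>. carrier G) \<and> l \<in> \<Lambda> \<and> vertex \<gamma> = bar G I l \<and>
        (\<forall>m\<in>\<Lambda>. component \<gamma> (bar G I m) = rho G I m l (g m)))"

end

theory Submission
  imports Defs
begin

text \<open>
  Distinct objects of \<open>\<L>(S)\<close> are incomparable sets, so the only inclusions and the only retractions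
  are identities, and every morphism \<open>\<rho>(g)\<close> is an isomorphism. Hence the cone condition and normality
  are automatic, a normal cone is just a vertex together with an arbitrary family in \<open>G\<^sup>\<Lambda>\<close>, and
  \<open>f\<^sup>\<circ> = f\<close> for every morphism, so the product of cones is composition with a single component.
\<close>

section \<open>Isomorphisms and semidirect products of semigroups\<close>

text \<open>Associativity of \<open>S\<close> is pulled back along the injective map \<phi> from
  \<open>T\<close>. The product of normal cones therefore only has to be closed and compatible with
  \<phi>; its associativity is never computed directly.\<close>

lemma sgrp_isoI:
  assumes "is_semigroup T" and "bij_betw \<phi> (carrier S) (carrier T)"
    and closed: "\<And>x y. x \<in> carrier S \<Longrightarrow> y \<in> carrier S \<Longrightarrow> smult S x y \<in> carrier S"
    and hom: "\<And>x y. x \<in> carrier S \<Longrightarrow> y \<in> carrier S \<Longrightarrow> \<phi> (smult S x y) = smult T (\<phi> x) (\<phi> y)"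
  shows "sgrp_iso S T \<phi>"
proof -
  have inj: "inj_on \<phi> (carrier S)" and into: "\<And>x. x \<in> carrier S \<Longrightarrow> \<phi> x \<in> carrier T"
    using assms(2) by (auto simp: bij_betw_def)
  have "smult S (smult S x y) z = smult S x (smult S y z)"
    if "x \<in> carrier S" "y \<in> carrier S" "z \<in> carrier S" for x y z
    using that assms(1)
    by (intro inj_onD[OF inj]) (simp_all add: hom closed into is_semigroup_def)
  then show ?thesis
    using assms by (simp add: sgrp_iso_def is_semigroup_def)
qed

lemma is_semigroup_semidirect:
  assumes "is_semigroup U" "is_semigroup T" "left_action T U act"
  shows "is_semigroup (semidirect U T act)"
  using assms by (auto simp: is_semigroup_def left_action_def semidirect_def)

lemma is_semigroup_sgrp_of: "monoid M \<Longrightarrow> is_semigroup (sgrp_of M)"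
  by (simp add: is_semigroup_def sgrp_of_def monoid.m_assoc monoid.m_closed)

lemma is_semigroup_right_zero: "is_semigroup (right_zero \<Lambda>)"
  by (simp add: is_semigroup_def right_zero_def)

text \<open>A constant function has the same value at every index, so in
  \<open>act t1 (act t2 s)\<close> only the value of \<open>s\<close> at \<open>t2\<close> survives.
  This agrees with the right zero product, which keeps \<open>t2\<close>.\<close>

lemma left_action_const_act:
  "left_action (right_zero \<Lambda>) (power_sgrp G \<Lambda>) (const_act \<Lambda>)"
  by (auto simp: left_action_def right_zero_def power_sgrp_def sgrp_of_def const_act_def
      restrict_def fun_eq_iff)

lemma is_semigroup_cone_semidirect: "group G \<Longrightarrow> is_semigroup (cone_semidirect G \<Lambda>)"
  unfolding cone_semidirect_def power_sgrp_def
  using left_action_const_act[of \<Lambda> G, unfolded power_sgrp_def]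
  by (intro is_semigroup_semidirect is_semigroup_sgrp_of is_semigroup_right_zero group.is_monoid)
    auto

section \<open>Objects and morphisms of the category of principal left ideals\<close>

text \<open>\<open>obj\<close>, \<open>arr\<close> and \<open>cmp\<close> are left out:
  \<open>obj_L\<close>, \<open>arr_L\<close> and \<open>cmp_rho\<close> express them through
  \<open>bar\<close> and \<open>rho\<close>, and later arguments work at that level.\<close>

lemma left_ideal_cat_simps:
  "src (left_ideal_cat S) = fst"
  "tgt (left_ideal_cat S) = fst \<circ> snd"
  "sub (left_ideal_cat S) = (\<subseteq>)"
  "incl (left_ideal_cat S) A B = (A, B, \<lambda>x\<in>A. x)"
  "idn (left_ideal_cat S) A = (A, A, \<lambda>x\<in>A. x)"
  by (auto simp: left_ideal_cat_def fun_eq_iff)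

lemma fst_rho [simp]: "fst (rho G I l m g) = bar G I l"
  and fst_snd_rho [simp]: "fst (snd (rho G I l m g)) = bar G I m"
  by (simp_all add: rho_def)

locale rees_matrix_data = group G for G :: "('g, 'x) monoid_scheme" (structure) +
  fixes I :: "'i set" and \<Lambda> :: "'l set" and P :: "'l \<Rightarrow> 'i \<Rightarrow> 'g"
  assumes I_nonempty: "I \<noteq> {}"
    and P_closed [simp, intro]: "l \<in> \<Lambda> \<Longrightarrow> i \<in> I \<Longrightarrow> P l i \<in> carrier G"
begin

abbreviation S where "S \<equiv> rees_matrix G I \<Lambda> P"
abbreviation L where "L \<equiv> left_ideal_cat S"

text \<open>All elements of \<open>bar G I l\<close> carry the last coordinate \<open>l\<close>, and
  nonemptiness of \<open>I\<close> guarantees that there is such an element to read it from.\<close>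

lemma bar_subset_iff: "bar G I l \<subseteq> bar G I m \<longleftrightarrow> l = m"
proof
  assume sub: "bar G I l \<subseteq> bar G I m"
  obtain i where "i \<in> I" using I_nonempty by blast
  then have "(\<one>, i, l) \<in> bar G I l" by (simp add: bar_def)
  with sub have "(\<one>, i, l) \<in> bar G I m" by blast
  then show "l = m" by (simp add: bar_def)
qed simp

lemma bar_eq_iff [simp]: "bar G I l = bar G I m \<longleftrightarrow> l = m"
  using bar_subset_iff[of l m] by auto

lemma rho_inject:
  assumes "g \<in> carrier G" "h \<in> carrier G" "rho G I l m g = rho G I l m h"
  shows "g = h"
proof -
  obtain i where "i \<in> I" using I_nonempty by blast
  \<comment> \<open>Evaluation at an element with group coordinate \<one> returns the translating
    group element as first coordinate.\<close>
  moreover have "snd (snd (rho G I l m g)) (\<one>, i, l) = snd (snd (rho G I l m h)) (\<one>, i, l)"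
    by (simp only: assms(3))
  ultimately show ?thesis
    using assms(1,2) by (simp add: rho_def bar_def)
qed

lemma cmp_rho:
  assumes "g \<in> carrier G" "h \<in> carrier G"
  shows "cmp L (rho G I l m g) (rho G I m n h) = rho G I l n (g \<otimes> h)"
  using assms
  by (auto simp: left_ideal_cat_def rho_def compose_def bar_def m_assoc fun_eq_iff restrict_def)

text \<open>Identities and inclusions of the category are stated as restricted identity maps. Read
  from right to left, this turns them into \<open>rho\<close>, so that \<open>cmp_rho\<close>
  applies.\<close>

lemma rho_one: "rho G I l l \<one> = (bar G I l, bar G I l, \<lambda>x\<in>bar G I l. x)"
  by (auto simp: rho_def bar_def fun_eq_iff restrict_def)

lemma principal_left_ideal_S:
  assumes "a \<in> carrier G" "i \<in> I" "l \<in> \<Lambda>"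
  shows "principal_left_ideal S (a, i, l) = bar G I l"
proof -
  have "(g, j, l) \<in> principal_left_ideal S (a, i, l)" if "g \<in> carrier G" "j \<in> I" for g j
  proof -
    \<comment> \<open>The first coordinate is the solution x of x p a = g in the group, where p is
      \<open>P l i\<close>.\<close>
    have "smult S (g \<otimes> inv (P l i \<otimes> a), j, l) (a, i, l) = (g, j, l)"
      using that assms by (simp add: rees_matrix_def m_assoc)
    moreover have "(g \<otimes> inv (P l i \<otimes> a), j, l) \<in> carrier S"
      using that assms by (simp add: rees_matrix_def)
    ultimately show ?thesis unfolding principal_left_ideal_def by force
  qed
  then show ?thesis
    using assms by (auto simp: principal_left_ideal_def bar_def rees_matrix_def)
qed

text \<open>Cancelling one factor a in a p a = a leaves a as the inverse of p, so each pair (i, l)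
  carries exactly one idempotent.\<close>

lemma idempotents_S: "idempotents S = {(inv (P l i), i, l) |i l. i \<in> I \<and> l \<in> \<Lambda>}"
proof -
  have "a \<otimes> P l i \<otimes> a = a \<longleftrightarrow> a = inv (P l i)"
    if "a \<in> carrier G" "l \<in> \<Lambda>" "i \<in> I" for a l i
    using that by (metis P_closed inv_equality m_closed r_cancel_one l_inv r_inv)
  then show ?thesis
    by (auto simp: idempotents_def rees_matrix_def)
qed

lemma principal_left_ideal_idempotent:
  "i \<in> I \<Longrightarrow> l \<in> \<Lambda> \<Longrightarrow> principal_left_ideal S (inv (P l i), i, l) = bar G I l"
  by (simp add: principal_left_ideal_S)

lemma obj_L: "obj L = bar G I ` \<Lambda>"
  using I_nonempty
  by (force simp: left_ideal_cat_def idempotents_S principal_left_ideal_S)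

text \<open>The sandwich entry \<open>P l i\<close> enters through the Rees product, so the
  translating element and the parameter of \<open>rho\<close> differ by this factor.\<close>

lemma right_translation_eq_rho:
  assumes "g \<in> carrier G" "i \<in> I" "l \<in> \<Lambda>"
  shows "(bar G I l, bar G I m, \<lambda>x\<in>bar G I l. smult S x (g, i, m)) = rho G I l m (P l i \<otimes> g)"
  using assms
  by (auto simp: rho_def bar_def rees_matrix_def fun_eq_iff restrict_def m_assoc)

lemma translators:
  assumes "i \<in> I" "l \<in> \<Lambda>" "j \<in> I" "m \<in> \<Lambda>"
  shows "{smult S (smult S (inv (P l i), i, l) y) (inv (P m j), j, m) |y. y \<in> carrier S}
    = carrier G \<times> {i} \<times> {m}" (is "?A = ?B")
proof
  show "?A \<subseteq> ?B"
    using assms by (auto simp: rees_matrix_def)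
next
  have "(g, i, m) \<in> ?A" if g: "g \<in> carrier G" for g
  proof -
    \<comment> \<open>The idempotents act as a left and a right identity on (g, i, m), which can
      thus serve as its own witness y.\<close>
    have "smult S (smult S (inv (P l i), i, l) (g, i, m)) (inv (P m j), j, m) = (g, i, m)"
      using assms g inv_solve_left'[of g "P l i" "P l i \<otimes> g"]
      by (simp add: rees_matrix_def m_assoc)
    moreover have "(g, i, m) \<in> carrier S"
      using assms g by (simp add: rees_matrix_def)
    ultimately show ?thesis by force
  qed
  then show "?B \<subseteq> ?A" by auto
qed

lemma arr_L: "arr L = {rho G I l m g |l m g. l \<in> \<Lambda> \<and> m \<in> \<Lambda> \<and> g \<in> carrier G}"
proof (intro equalityI subsetI)
  fix f assume "f \<in> arr L"
  then obtain a b s where ab: "a \<in> idempotents S" "b \<in> idempotents S"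
    and s: "s \<in> {smult S (smult S a y) b |y. y \<in> carrier S}"
    and f: "f = (principal_left_ideal S a, principal_left_ideal S b,
      \<lambda>x\<in>principal_left_ideal S a. smult S x s)"
    unfolding left_ideal_cat_def incl_cat.simps by blast
  from ab obtain i l j m where a: "a = (inv (P l i), i, l)" and b: "b = (inv (P m j), j, m)"
    and ij: "i \<in> I" "l \<in> \<Lambda>" "j \<in> I" "m \<in> \<Lambda>"
    unfolding idempotents_S by blast
  from s obtain g where g: "g \<in> carrier G" "s = (g, i, m)"
    unfolding a b translators[OF ij] by auto
  have "f = rho G I l m (P l i \<otimes> g)"
    using ij g by (simp add: f a b principal_left_ideal_idempotent right_translation_eq_rho)
  moreover have "P l i \<otimes> g \<in> carrier G"
    using ij g by simp
  ultimately show "f \<in> {rho G I l m g |l m g. l \<in> \<Lambda> \<and> m \<in> \<Lambda> \<and> g \<in> carrier G}"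
    using ij by blast
next
  fix f assume "f \<in> {rho G I l m g |l m g. l \<in> \<Lambda> \<and> m \<in> \<Lambda> \<and> g \<in> carrier G}"
  then obtain l m g where f: "f = rho G I l m g" and lm: "l \<in> \<Lambda>" "m \<in> \<Lambda>" "g \<in> carrier G"
    by blast
  obtain i where i: "i \<in> I" using I_nonempty by blast
  \<comment> \<open>The factor \<open>inv (P l i)\<close> in \<open>?s\<close> cancels the entry
    produced by right translation. One index i serves for both idempotents, since the left ideal
    depends only on the last coordinate.\<close>
  let ?e = "(inv (P l i), i, l)" and ?f = "(inv (P m i), i, m)"
    and ?s = "(inv (P l i) \<otimes> g, i, m)"
  have "f = (bar G I l, bar G I m, \<lambda>x\<in>bar G I l. smult S x ?s)"
    using lm i by (simp add: f right_translation_eq_rho m_assoc[symmetric])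
  then have "f = (principal_left_ideal S ?e, principal_left_ideal S ?f,
      \<lambda>x\<in>principal_left_ideal S ?e. smult S x ?s)"
    using lm i by (simp add: principal_left_ideal_idempotent)
  moreover have "?e \<in> idempotents S" "?f \<in> idempotents S"
    using lm i by (auto simp: idempotents_S)
  moreover have "?s \<in> {smult S (smult S ?e y) ?f |y. y \<in> carrier S}"
    using lm i unfolding translators[OF i lm(1) i lm(2)] by simp
  ultimately show "f \<in> arr L"
    unfolding left_ideal_cat_def by simp blast
qed

lemma homs_L:
  "l \<in> \<Lambda> \<Longrightarrow> m \<in> \<Lambda> \<Longrightarrow> homs L (bar G I l) (bar G I m) = rho G I l m ` carrier G"
  by (auto simp: homs_def arr_L left_ideal_cat_simps)

section \<open>Isomorphisms, retractions and epimorphic components\<close>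

lemma is_isomorphism_rho:
  assumes "l \<in> \<Lambda>" "m \<in> \<Lambda>" "g \<in> carrier G"
  shows "is_isomorphism L (rho G I l m g)"
proof -
  have "rho G I m l (inv g) \<in> homs L (bar G I m) (bar G I l)"
    using assms by (simp add: homs_L)
  moreover have "rho G I l m g \<in> arr L"
    using assms by (auto simp: arr_L)
  ultimately show ?thesis
    using assms
    by (auto simp: is_isomorphism_def left_ideal_cat_simps cmp_rho rho_one[symmetric]
        intro!: bexI[where x = "rho G I m l (inv g)"])
qed

lemma is_inclusion_L: "is_inclusion L j \<longleftrightarrow> (\<exists>l\<in>\<Lambda>. j = rho G I l l \<one>)"
  by (auto simp: is_inclusion_def obj_L left_ideal_cat_simps bar_subset_iff rho_one)

text \<open>Comparability of its endpoints makes a retraction an endomorphism of a single object.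
  Composing with the inclusion, here an identity, does not change it, so the splitting equation says
  that it is the identity itself.\<close>

lemma is_retraction_L: "is_retraction L e \<longleftrightarrow> (\<exists>l\<in>\<Lambda>. e = rho G I l l \<one>)"
proof
  assume "is_retraction L e"
  then obtain l where l: "l \<in> \<Lambda>" "e \<in> homs L (bar G I l) (bar G I l)"
    and id: "cmp L (rho G I l l \<one>) e = rho G I l l \<one>"
    by (auto simp: is_retraction_def obj_L left_ideal_cat_simps bar_subset_iff rho_one)
  then show "\<exists>l\<in>\<Lambda>. e = rho G I l l \<one>"
    by (auto simp: homs_L cmp_rho)
next
  assume "\<exists>l\<in>\<Lambda>. e = rho G I l l \<one>"
  then obtain l where l: "l \<in> \<Lambda>" "e = rho G I l l \<one>" by blast
  have "cmp L (incl L (bar G I l) (bar G I l)) e = idn L (bar G I l)"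
    by (simp add: l(2) left_ideal_cat_simps(4,5) rho_one[symmetric] cmp_rho)
  then show "is_retraction L e"
    using l by (auto simp: is_retraction_def obj_L homs_L left_ideal_cat_simps(3))
qed

text \<open>The definite description needs both a factorization and the uniqueness of its epimorphic
  part. In any factorization the outer factors are identities, so the epimorphic part is the whole
  morphism.\<close>

lemma epi_component_rho:
  assumes "l \<in> \<Lambda>" "m \<in> \<Lambda>" "g \<in> carrier G"
  shows "epi_component L (rho G I l m g) = rho G I l m g"
  unfolding epi_component_def
proof (rule the_equality)
  show "\<exists>e u j. is_retraction L e \<and> is_isomorphism L u \<and> is_inclusion L j \<and>
     tgt L e = src L u \<and> tgt L u = src L j \<and>
     rho G I l m g = cmp L (cmp L e u) j \<and> rho G I l m g = cmp L e u"
    using assms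
    by (intro exI[where x = "rho G I l l \<one>"] exI[where x = "rho G I l m g"]
        exI[where x = "rho G I m m \<one>"])
      (auto simp: is_retraction_L is_inclusion_L is_isomorphism_rho cmp_rho left_ideal_cat_simps)
next
  fix q assume "\<exists>e u j. is_retraction L e \<and> is_isomorphism L u \<and> is_inclusion L j \<and>
     tgt L e = src L u \<and> tgt L u = src L j \<and>
     rho G I l m g = cmp L (cmp L e u) j \<and> q = cmp L e u"
  then obtain e u j where e: "is_retraction L e" and u: "is_isomorphism L u"
    and j: "is_inclusion L j" and eu: "tgt L e = src L u" and uj: "tgt L u = src L j"
    and f: "rho G I l m g = cmp L (cmp L e u) j" and q: "q = cmp L e u"
    by blast
  from u obtain a b c where u: "u = rho G I a b c" and c: "c \<in> carrier G"
    by (auto simp: is_isomorphism_def arr_L)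
  \<comment> \<open>The matching endpoints decide which identities occur: the one at the source of u
    and the one at its target.\<close>
  have "e = rho G I a a \<one>" "j = rho G I b b \<one>"
    using e j eu uj by (auto simp: is_retraction_L is_inclusion_L u left_ideal_cat_simps)
  then show "q = rho G I l m g"
    using c by (simp add: f q u cmp_rho)
qed

section \<open>Normal cones as pairs of a function and an index\<close>

lemma corresponds_unique:
  assumes "corresponds G I \<Lambda> \<gamma> p" "corresponds G I \<Lambda> \<gamma> q"
  shows "p = q"
proof -
  obtain g l h m where pq: "p = (g, l)" "q = (h, m)" by (cases p, cases q)
  with assms have gh: "g \<in> (\<Pi>\<^sub>E m\<in>\<Lambda>. carrier G)" "h \<in> (\<Pi>\<^sub>E m\<in>\<Lambda>. carrier G)"
    and "l = m" and "\<And>k. k \<in> \<Lambda> \<Longrightarrow> rho G I k l (g k) = rho G I k l (h k)"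
    by (auto simp: corresponds_def)
  then have "g k = h k" if "k \<in> \<Lambda>" for k
    using that by (blast intro: rho_inject)
  then have "g = h" using gh by (blast intro: PiE_ext)
  with \<open>l = m\<close> pq show ?thesis by simp
qed

text \<open>\<open>corresponds\<close> says nothing about components at sets that are not objects,
  hence the separate extensionality clause.\<close>

lemma is_normal_cone_iff:
  "is_normal_cone L \<gamma> \<longleftrightarrow>
     component \<gamma> \<in> extensional (bar G I ` \<Lambda>) \<and> (\<exists>p. corresponds G I \<Lambda> \<gamma> p)"
proof
  assume "is_normal_cone L \<gamma>"
  then have "vertex \<gamma> \<in> bar G I ` \<Lambda>"
    and comp: "component \<gamma> \<in> (\<Pi>\<^sub>E c\<in>bar G I ` \<Lambda>. homs L c (vertex \<gamma>))"
    unfolding is_normal_cone_def is_cone_def obj_L by blast+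
  from comp have "component \<gamma> \<in> extensional (bar G I ` \<Lambda>)"
    by (simp add: PiE_def)
  from \<open>vertex \<gamma> \<in> bar G I ` \<Lambda>\<close> obtain l where l: "l \<in> \<Lambda>" "vertex \<gamma> = bar G I l" by blast
  \<comment> \<open>One group element is chosen for each component; restricting the choice function
    to \<Lambda> then gives an element of the power of G.\<close>
  have "\<forall>m\<in>\<Lambda>. \<exists>g\<in>carrier G. component \<gamma> (bar G I m) = rho G I m l g"
  proof
    fix m assume m: "m \<in> \<Lambda>"
    with comp have "component \<gamma> (bar G I m) \<in> homs L (bar G I m) (vertex \<gamma>)"
      by (blast intro: PiE_mem)
    then show "\<exists>g\<in>carrier G. component \<gamma> (bar G I m) = rho G I m l g"
      using m l by (auto simp: homs_L)
  qed
  then obtain g where "\<forall>m\<in>\<Lambda>. g m \<in> carrier G \<and> component \<gamma> (bar G I m) = rho G I m l (g m)"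
    by metis
  then have "corresponds G I \<Lambda> \<gamma> (restrict g \<Lambda>, l)"
    using l by (auto simp: corresponds_def)
  with \<open>component \<gamma> \<in> extensional (bar G I ` \<Lambda>)\<close>
  show "component \<gamma> \<in> extensional (bar G I ` \<Lambda>) \<and> (\<exists>p. corresponds G I \<Lambda> \<gamma> p)"
    by blast
next
  assume "component \<gamma> \<in> extensional (bar G I ` \<Lambda>) \<and> (\<exists>p. corresponds G I \<Lambda> \<gamma> p)"
  then obtain p where ext: "component \<gamma> \<in> extensional (bar G I ` \<Lambda>)"
    and "corresponds G I \<Lambda> \<gamma> p" by blast
  then obtain g l where g: "\<And>m. m \<in> \<Lambda> \<Longrightarrow> g m \<in> carrier G" and l: "l \<in> \<Lambda>"
    and v: "vertex \<gamma> = bar G I l"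
    and comp: "\<And>m. m \<in> \<Lambda> \<Longrightarrow> component \<gamma> (bar G I m) = rho G I m l (g m)"
    by (cases p) (auto simp: corresponds_def)
  have "is_cone L \<gamma>"
    using ext g l v comp
    by (auto simp: is_cone_def obj_L homs_L PiE_iff left_ideal_cat_simps bar_subset_iff
        rho_one[symmetric] cmp_rho)
  \<comment> \<open>Every component is an isomorphism; the one at the vertex is always at
    hand.\<close>
  moreover have "is_isomorphism L (component \<gamma> (bar G I l))"
    using g l comp is_isomorphism_rho by simp
  ultimately show "is_normal_cone L \<gamma>"
    using l by (auto simp: is_normal_cone_def obj_L)
qed

lemma normal_cone_eqI:
  assumes "is_normal_cone L \<gamma>" "is_normal_cone L \<sigma>"
    and "corresponds G I \<Lambda> \<gamma> p" "corresponds G I \<Lambda> \<sigma> p"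
  shows "\<gamma> = \<sigma>"
proof (rule cone.equality)
  show "component \<gamma> = component \<sigma>"
  proof (rule extensionalityI)
    show "component \<gamma> \<in> extensional (bar G I ` \<Lambda>)" "component \<sigma> \<in> extensional (bar G I ` \<Lambda>)"
      using assms(1,2) by (simp_all add: is_normal_cone_iff)
  qed (use assms(3,4) in \<open>auto simp: corresponds_def split: prod.splits\<close>)
qed (use assms(3,4) in \<open>auto simp: corresponds_def split: prod.splits\<close>)

lemma ex_normal_cone_corresponds:
  assumes "g \<in> (\<Pi>\<^sub>E m\<in>\<Lambda>. carrier G)" "l \<in> \<Lambda>"
  shows "\<exists>\<gamma>. is_normal_cone L \<gamma> \<and> corresponds G I \<Lambda> \<gamma> (g, l)"
proof -
  have inj: "inj_on (bar G I) \<Lambda>" by (simp add: inj_on_def)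
  \<comment> \<open>Components are indexed by ideals, whereas g is indexed by \<Lambda>; injectivity
    of \<open>bar G I\<close> recovers the index from the ideal.\<close>
  let ?\<gamma> = "\<lparr>vertex = bar G I l, component = \<lambda>A\<in>bar G I ` \<Lambda>.
    let m = the_inv_into \<Lambda> (bar G I) A in rho G I m l (g m)\<rparr>"
  have "corresponds G I \<Lambda> ?\<gamma> (g, l)"
    using assms by (simp add: corresponds_def the_inv_into_f_f[OF inj])
  moreover from this have "is_normal_cone L ?\<gamma>"
    by (auto simp: is_normal_cone_iff)
  ultimately show ?thesis by blast
qed

section \<open>The product of cones and the isomorphism\<close>

text \<open>With l the vertex index of \<gamma> and h the function of \<sigma>, the product composes
  every component of \<gamma> with the same morphism, whose parameter is \<open>h l\<close>. This
  common right factor is the constant function that the action of l makes of h.\<close>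

lemma cone_mult_corresponds:
  assumes "corresponds G I \<Lambda> \<gamma> p" "corresponds G I \<Lambda> \<sigma> q"
  shows "corresponds G I \<Lambda> (cone_mult L \<gamma> \<sigma>) (smult (cone_semidirect G \<Lambda>) p q)"
proof -
  obtain g l h m where pq: "p = (g, l)" "q = (h, m)" by (cases p, cases q)
  with assms have g: "\<And>k. k \<in> \<Lambda> \<Longrightarrow> g k \<in> carrier G" and h: "\<And>k. k \<in> \<Lambda> \<Longrightarrow> h k \<in> carrier G"
    and lm: "l \<in> \<Lambda>" "m \<in> \<Lambda>" and v: "vertex \<gamma> = bar G I l"
    and c: "\<And>k. k \<in> \<Lambda> \<Longrightarrow> component \<gamma> (bar G I k) = rho G I k l (g k)"
      "\<And>k. k \<in> \<Lambda> \<Longrightarrow> component \<sigma> (bar G I k) = rho G I k m (h k)"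
    by (auto simp: corresponds_def)
  have "smult (cone_semidirect G \<Lambda>) p q = (\<lambda>k\<in>\<Lambda>. g k \<otimes> h l, m)"
    by (auto simp: pq cone_semidirect_def semidirect_def power_sgrp_def sgrp_of_def
        right_zero_def const_act_def restrict_def fun_eq_iff)
  then show ?thesis
    using g h lm v c
    by (auto simp: corresponds_def cone_mult_def Let_def epi_component_rho obj_L cmp_rho
        left_ideal_cat_simps)
qed

lemma is_normal_cone_cone_mult:
  assumes "is_normal_cone L \<gamma>" "is_normal_cone L \<sigma>"
  shows "is_normal_cone L (cone_mult L \<gamma> \<sigma>)"
proof -
  have "component (cone_mult L \<gamma> \<sigma>) \<in> extensional (bar G I ` \<Lambda>)"
    by (simp add: cone_mult_def Let_def obj_L)
  then show ?thesis
    using assms cone_mult_corresponds unfolding is_normal_cone_iff by blast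
qed

lemma ex1_corresponds: "is_normal_cone L \<gamma> \<Longrightarrow> \<exists>!p. corresponds G I \<Lambda> \<gamma> p"
  using corresponds_unique is_normal_cone_iff by blast

lemma sgrp_iso_normal_cones:
  "sgrp_iso (normal_cones L) (cone_semidirect G \<Lambda>) (\<lambda>\<gamma>. THE p. corresponds G I \<Lambda> \<gamma> p)"
    (is "sgrp_iso _ _ ?\<phi>")
proof -
  have the: "?\<phi> \<gamma> = p" if "corresponds G I \<Lambda> \<gamma> p" for \<gamma> p
    using that corresponds_unique by blast
  have corr: "corresponds G I \<Lambda> \<gamma> (?\<phi> \<gamma>)" if "is_normal_cone L \<gamma>" for \<gamma>
    using ex1_corresponds[OF that] by (rule theI')
  have carrier: "carrier (cone_semidirect G \<Lambda>) = (\<Pi>\<^sub>E m\<in>\<Lambda>. carrier G) \<times> \<Lambda>"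
    by (simp add: cone_semidirect_def semidirect_def power_sgrp_def sgrp_of_def right_zero_def)
  have "bij_betw ?\<phi> {\<gamma>. is_normal_cone L \<gamma>} ((\<Pi>\<^sub>E m\<in>\<Lambda>. carrier G) \<times> \<Lambda>)"
    unfolding bij_betw_def
  proof (intro conjI equalityI subsetI)
    show "inj_on ?\<phi> {\<gamma>. is_normal_cone L \<gamma>}"
      by (rule inj_onI) (metis corr normal_cone_eqI mem_Collect_eq)
  next
    fix p assume "p \<in> ?\<phi> ` {\<gamma>. is_normal_cone L \<gamma>}"
    then obtain \<gamma> where "corresponds G I \<Lambda> \<gamma> p" using corr by blast
    then show "p \<in> (\<Pi>\<^sub>E m\<in>\<Lambda>. carrier G) \<times> \<Lambda>"
      by (auto simp: corresponds_def)
  next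
    fix p assume "p \<in> (\<Pi>\<^sub>E m\<in>\<Lambda>. carrier G) \<times> \<Lambda>"
    then obtain \<gamma> where "is_normal_cone L \<gamma>" "corresponds G I \<Lambda> \<gamma> p"
      using ex_normal_cone_corresponds by blast
    then show "p \<in> ?\<phi> ` {\<gamma>. is_normal_cone L \<gamma>}"
      using the by blast
  qed
  then show ?thesis
    by (intro sgrp_isoI is_semigroup_cone_semidirect is_group)
      (auto simp: normal_cones_def carrier intro!: is_normal_cone_cone_mult the
        cone_mult_corresponds corr)
qed

end

theorem proposition16:
  fixes G :: "('g, 'x) monoid_scheme"
    and I :: "'i set" and \<Lambda> :: "'l set"
    and P :: "'l \<Rightarrow> 'i \<Rightarrow> 'g"
  assumes "group G"
    and "I \<noteq> {}" and "\<Lambda> \<noteq> {}"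
    and "\<forall>l\<in>\<Lambda>. \<forall>i\<in>I. P l i \<in> carrier G"
  shows "left_action (right_zero \<Lambda>) (power_sgrp G \<Lambda>) (const_act \<Lambda>) \<and>
    (\<forall>\<gamma> \<in> carrier (normal_cones (left_ideal_cat (rees_matrix G I \<Lambda> P))).
       \<exists>!p. corresponds G I \<Lambda> \<gamma> p) \<and>
    sgrp_iso (normal_cones (left_ideal_cat (rees_matrix G I \<Lambda> P)))
      (cone_semidirect G \<Lambda>)
      (\<lambda>\<gamma>. THE p. corresponds G I \<Lambda> \<gamma> p)"
proof -
  interpret rees_matrix_data G I \<Lambda> P
    using assms by (simp add: rees_matrix_data_def rees_matrix_data_axioms_def)
  have "\<forall>\<gamma> \<in> carrier (normal_cones L). \<exists>!p. corresponds G I \<Lambda> \<gamma> p"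
    by (simp add: normal_cones_def ex1_corresponds)
  then show ?thesis
    using left_action_const_act sgrp_iso_normal_cones by blast
qed

end
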